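(* Let $\mu=\prod_{j=1}^{\infty}|P_j|^2$ and $\nu=\prod_{j=1}^{\infty}|Q_j|^2$ be two generalized Riesz products, and let $\mu_n=\prod_{j=n+1}^{\infty}|P_j|^2$, $\nu_n=\prod_{j=n+1}^{\infty}|Q_j|^2$. Assume that 1. $\nu=\nu'+b\,\delta_1$, where $\nu'$ is a continuous (i.e. atomless) measure, $\delta_1$ is the unit mass at $1\in S^1$, and $0\le b<1$; 2. $\prod_{j=1}^{n}|P_j|^2\,d\nu_n\to\mu$ weakly as $n\to\infty$; 3. $\prod_{j=1}^{n}|Q_j|^2\,d\mu_n\to\nu$ weakly as $n\to\infty$. Then the finite products $R_n(z)=\prod_{k=1}^{n}\left|\frac{P_k(z)}{Q_k(z)}\right|$, $n=1,2,\dots$, converge in $L^1(S^1,\nu)$ to $\sqrt{\frac{d\mu}{d\nu}}$.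
   Context: $S^1$ is the unit circle and $dz$ denotes normalized Lebesgue measure on $S^1$. For measures $\sigma,\tau$ on $S^1$, $\frac{d\sigma}{d\tau}$ denotes the Radon–Nikodym derivative of the $\tau$-absolutely continuous part of $\sigma$ in its Lebesgue decomposition with respect to $\tau$. Generalized Riesz product: a sequence $P_1,P_2,\dots$ of trigonometric polynomials on $S^1$ (taken to be analytic, i.e. of the form $\sum_{i=0}^m a_iz^i$, with positive constant term) is said to define a generalized Riesz product if (i) for every finite sequence $i_1<\dots<i_k$ of natural numbers, $\int_{S^1}|P_{i_1}\cdots P_{i_k}(z)|^2\,dz=1$; and (ii) for every infinite sequence $i_1<i_2<\cdots$ of natural numbers, the weak limit of the probability measures $|P_{i_1}\cdots P_{i_k}(z)|^2\,dz$ as $k\to\infty$ exists. The weak limit of $|P_1\cdots P_k|^2dz$ is denoted $\prod_{j=1}^\infty|P_j|^2$, and $\prod_{j=n+1}^\infty|P_j|^2$ denotes the weak limit of $|P_{n+1}\cdots P_{n+k}|^2dz$ as $k\to\infty$. The functions $R_n$ are defined $\nu$-almost everywhere. *)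

theory Defs
  imports "HOL-Probability.Giry_Monad" "HOL-Computational_Algebra.Polynomial"
begin

definition circle :: "complex measure" where
  "circle = restrict_space borel (sphere 0 1)"

definition circle_lebesgue :: "complex measure" where
  "circle_lebesgue = distr (uniform_measure lborel {0..<1::real}) circle (\<lambda>t. cis (2 * pi * t))"

definition circle_measure :: "complex measure \<Rightarrow> bool" where
  "circle_measure M \<longleftrightarrow> finite_measure M \<and> sets M = sets circle"

definition weak_limit :: "(nat \<Rightarrow> complex measure) \<Rightarrow> complex measure \<Rightarrow> bool" where
  "weak_limit M L \<longleftrightarrow>
     (\<forall>n. circle_measure (M n)) \<and> circle_measure L \<and>
     (\<forall>f :: complex \<Rightarrow> real. continuous_on (sphere 0 1) f \<longrightarrow>
        (\<lambda>n. \<integral>z. f z \<partial>M n) \<longlonglongrightarrow> (\<integral>z. f z \<partial>L))"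

definition sq_prod :: "(nat \<Rightarrow> complex poly) \<Rightarrow> nat set \<Rightarrow> complex \<Rightarrow> real" where
  "sq_prod P I z = (\<Prod>j\<in>I. (cmod (poly (P j) z))\<^sup>2)"

text \<open>The polynomials are \<open>P 1, P 2, \<dots>\<close>; the value \<open>P 0\<close> is never used. The finite
  sequences \<open>i\<^sub>1 < \<dots> < i\<^sub>k\<close> of condition (i) are the finite subsets of \<open>{1..}\<close>.\<close>

definition generalized_riesz_product :: "(nat \<Rightarrow> complex poly) \<Rightarrow> bool" where
  "generalized_riesz_product P \<longleftrightarrow>
     (\<forall>j\<ge>1. coeff (P j) 0 \<in> \<real> \<and> 0 < Re (coeff (P j) 0)) \<and>
     (\<forall>I. finite I \<and> I \<subseteq> {1..} \<longrightarrow> (\<integral>z. sq_prod P I z \<partial>circle_lebesgue) = 1) \<and>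
     (\<forall>i :: nat \<Rightarrow> nat. strict_mono i \<and> 1 \<le> i 0 \<longrightarrow>
        (\<exists>L. weak_limit (\<lambda>k. density circle_lebesgue (\<lambda>z. ennreal (sq_prod P (i ` {..<k}) z))) L))"

text \<open>\<open>is_tail_product P n M\<close> says that \<open>M\<close> is the measure \<open>\<Prod>\<^sub>j\<^sub>\<ge>\<^sub>n\<^sub>+\<^sub>1 |P\<^sub>j|\<^sup>2\<close>; weak limits being
  unique, this determines \<open>M\<close>. For \<open>n = 0\<close> it is the full product.\<close>

definition is_tail_product :: "(nat \<Rightarrow> complex poly) \<Rightarrow> nat \<Rightarrow> complex measure \<Rightarrow> bool" where
  "is_tail_product P n M \<longleftrightarrow>
     weak_limit (\<lambda>k. density circle_lebesgue (\<lambda>z. ennreal (sq_prod P {n+1..n+k} z))) M"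

definition mutually_singular :: "'a measure \<Rightarrow> 'a measure \<Rightarrow> bool" where
  "mutually_singular M N \<longleftrightarrow>
     (\<exists>A\<in>sets M. A \<in> null_sets M \<and> space M - A \<in> null_sets N)"

definition lebesgue_decomposition ::
  "'a measure \<Rightarrow> 'a measure \<Rightarrow> 'a measure \<Rightarrow> 'a measure \<Rightarrow> bool" where
  "lebesgue_decomposition \<tau> \<sigma> \<sigma>a \<sigma>s \<longleftrightarrow>
     sets \<sigma>a = sets \<tau> \<and> sets \<sigma>s = sets \<tau> \<and>
     absolutely_continuous \<tau> \<sigma>a \<and> mutually_singular \<tau> \<sigma>s \<and>
     (\<forall>A\<in>sets \<tau>. emeasure \<sigma> A = emeasure \<sigma>a A + emeasure \<sigma>s A)"

text \<open>The library's \<open>RN_deriv \<tau> \<sigma>\<close> is zero unless \<open>\<sigma>\<close> has a density with respect to \<open>\<tau>\<close>, so it is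
  applied to the absolutely continuous part only. For finite measures the Lebesgue
  decomposition exists and is unique.\<close>

definition ac_part :: "'a measure \<Rightarrow> 'a measure \<Rightarrow> 'a measure" where
  "ac_part \<tau> \<sigma> = (THE \<sigma>a. \<exists>\<sigma>s. lebesgue_decomposition \<tau> \<sigma> \<sigma>a \<sigma>s)"

definition ac_deriv :: "'a measure \<Rightarrow> 'a measure \<Rightarrow> 'a \<Rightarrow> real" where
  "ac_deriv \<tau> \<sigma> z = enn2real (RN_deriv \<tau> (ac_part \<tau> \<sigma>) z)"

definition converges_in_L1 :: "'a measure \<Rightarrow> (nat \<Rightarrow> 'a \<Rightarrow> real) \<Rightarrow> ('a \<Rightarrow> real) \<Rightarrow> bool" where
  "converges_in_L1 M f g \<longleftrightarrow>
     (\<forall>n. integrable M (f n)) \<and> integrable M g \<and>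
     (\<lambda>n. \<integral>z. \<bar>f n z - g z\<bar> \<partial>M) \<longlonglongrightarrow> 0"

end

theory Submission
  imports Defs
begin

text \<open>
  Put \<open>p\<^sub>n = \<Prod>\<^sub>j\<^sub>\<le>\<^sub>n |P\<^sub>j|\<^sup>2\<close>, \<open>q\<^sub>n = \<Prod>\<^sub>j\<^sub>\<le>\<^sub>n |Q\<^sub>j|\<^sup>2\<close>, \<open>R\<^sub>n = sqrt (p\<^sub>n / q\<^sub>n)\<close> and
  \<open>f = sqrt (d\<mu>/d\<nu>)\<close>. Pulling finitely many continuous factors out of a weak limit gives
  \<open>\<mu> = p\<^sub>n \<mu>\<^sub>n\<close> and \<open>\<nu> = q\<^sub>n \<nu>\<^sub>n\<close> (\<open>tail_product_factorization\<close>). Therefore \<open>R\<^sub>n\<^sup>2 d\<nu>\<close> is at most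
  \<open>p\<^sub>n d\<nu>\<^sub>n\<close>, a measure that tends weakly to \<open>\<mu>\<close>, and symmetrically \<open>R\<^sub>n\<^sup>-\<^sup>2 d\<mu>\<close> is at most
  \<open>q\<^sub>n d\<mu>\<^sub>n\<close>, which tends weakly to \<open>\<nu>\<close>.

  For a continuous weight \<open>h > 0\<close>, the inequalities \<open>2 R \<le> h R\<^sup>2 + 1/h\<close> and
  \<open>2 / R \<le> h + 1 / (h R\<^sup>2)\<close> (\<open>integral_sqrt_ratio_le\<close>, used twice) turn this into
  \<open>limsup (\<integral> R\<^sub>n d\<nu> + \<integral> f\<^sup>2 / R\<^sub>n d\<nu>) \<le> \<integral> h d\<mu> + \<integral> 1/h d\<nu>\<close>,
  because \<open>f\<^sup>2 d\<nu>\<close> is the absolutely continuous part of \<open>\<mu>\<close>. The infimum of the right-hand side over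
  \<open>h\<close> is twice the Hellinger affinity \<open>\<integral> f d\<nu>\<close> (\<open>approx_affinity\<close>). In other words, the affinity
  is upper semicontinuous for weak convergence, and this is applied to both mixed sequences.

  Finally \<open>\<integral> R\<^sub>n + \<integral> f\<^sup>2 / R\<^sub>n - 2 \<integral> f = \<integral> (R\<^sub>n - f)\<^sup>2 / R\<^sub>n\<close> is nonnegative, so it tends to 0. As
  \<open>\<integral> R\<^sub>n\<close> stays bounded, the Cauchy-Schwarz inequality gives \<open>\<integral> |R\<^sub>n - f| d\<nu> \<rightarrow> 0\<close> (\<open>converges_in_L1_sqrt\<close>).
\<close>

section \<open>Approximation by continuous functions\<close>

text \<open>Two finite measures will have to be approximated simultaneously. Their supremum
  \<open>sup_measure'\<close> is a finite measure dominating both, and integrals are monotone in the measure,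
  so it is enough to treat one measure.\<close>

lemma nn_integral_mono_measure:
  assumes sets: "sets M = sets N" and le: "\<And>A. A \<in> sets M \<Longrightarrow> emeasure M A \<le> emeasure N A"
    and f: "f \<in> borel_measurable M"
  shows "(\<integral>\<^sup>+x. f x \<partial>M) \<le> (\<integral>\<^sup>+x. f x \<partial>N)"
  using f
proof induction
  case (cong f g)
  have "(\<integral>\<^sup>+x. f x \<partial>N) = (\<integral>\<^sup>+x. g x \<partial>N)"
    using cong.hyps(3) sets_eq_imp_space_eq[OF sets] by (intro nn_integral_cong) auto
  with cong show ?case
    by (metis nn_integral_cong)
next
  case (set A)
  then show ?case
    using le sets by simp
next
  case (mult u c)
  have u: "u \<in> borel_measurable N" using mult sets by (simp cong: measurable_cong_sets)
  show ?case
    using mult.IH by (simp add: nn_integral_cmult u mult.hyps mult_left_mono)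
next
  case (add u v)
  have "u \<in> borel_measurable N" "v \<in> borel_measurable N"
    using add sets by (simp_all cong: measurable_cong_sets)
  then show ?case
    using add.IH by (simp add: nn_integral_add add.hyps add_mono)
next
  case (seq U)
  have "\<And>i. U i \<in> borel_measurable N" using seq sets by (simp cong: measurable_cong_sets)
  then have *: "(\<integral>\<^sup>+x. (SUP i. U i x) \<partial>N) = (SUP i. \<integral>\<^sup>+x. U i x \<partial>N)"
    by (intro nn_integral_monotone_convergence_SUP seq)
  have "(\<integral>\<^sup>+x. (SUP i. U i x) \<partial>M) = (SUP i. \<integral>\<^sup>+x. U i x \<partial>M)"
    by (intro nn_integral_monotone_convergence_SUP seq)
  also have "\<dots> \<le> (SUP i. \<integral>\<^sup>+x. U i x \<partial>N)"
    by (intro SUP_mono) (use seq.IH in auto)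
  finally show ?case
    using * by (simp add: image_comp)
qed

lemma integral_mono_measure:
  fixes f :: "'a \<Rightarrow> real"
  assumes sets: "sets M = sets N" and le: "\<And>A. A \<in> sets M \<Longrightarrow> emeasure M A \<le> emeasure N A"
    and f: "integrable N f" and nn: "\<And>x. x \<in> space N \<Longrightarrow> 0 \<le> f x"
  shows "integrable M f" "(\<integral>x. f x \<partial>M) \<le> (\<integral>x. f x \<partial>N)"
proof -
  have sp: "space M = space N" using sets by (rule sets_eq_imp_space_eq)
  have meas: "f \<in> borel_measurable M"
    using borel_measurable_integrable[OF f] sets by (simp cong: measurable_cong_sets)
  have "(\<integral>\<^sup>+x. ennreal (f x) \<partial>M) \<le> (\<integral>\<^sup>+x. ennreal (f x) \<partial>N)"
    by (rule nn_integral_mono_measure[OF sets le]) (use meas in auto)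
  also have N: "\<dots> = ennreal (\<integral>x. f x \<partial>N)"
    using f nn by (intro nn_integral_eq_integral) auto
  finally have *: "(\<integral>\<^sup>+x. ennreal (f x) \<partial>M) \<le> ennreal (\<integral>x. f x \<partial>N)" .
  show int: "integrable M f"
    using meas nn sp * by (intro integrableI_nonneg) (auto intro: le_less_trans)
  have "(\<integral>\<^sup>+x. ennreal (f x) \<partial>M) = ennreal (\<integral>x. f x \<partial>M)"
    using int nn sp by (intro nn_integral_eq_integral) auto
  with * show "(\<integral>x. f x \<partial>M) \<le> (\<integral>x. f x \<partial>N)"
    using nn by (simp add: ennreal_le_iff integral_nonneg)
qed

lemma finite_measure_sup_measure':
  assumes "finite_measure M" "finite_measure N" "sets N = sets M"
  shows "finite_measure (sup_measure' M N)"
proof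
  interpret M: finite_measure M by fact
  interpret N: finite_measure N by fact
  have "emeasure (sup_measure' M N) (space M)
      = (SUP Y\<in>sets M. emeasure M (space M \<inter> Y) + emeasure N (space M \<inter> - Y))"
    by (rule emeasure_sup_measure'[OF assms(3) sets.top])
  also have "\<dots> \<le> emeasure M (space M) + emeasure N (space N)"
    by (intro SUP_least add_mono emeasure_space)
  also have "\<dots> < \<infinity>"
    by (simp add: less_top[symmetric])
  finally show "emeasure (sup_measure' M N) (space (sup_measure' M N)) \<noteq> \<infinity>"
    unfolding space_sup_measure'[OF assms(3)] by simp
qed

text \<open>Continuous functions are dense in \<open>L\<^sup>1\<close>. For an indicator this is regularity of the measure:
  squeeze the set between a compact and an open set of nearly equal measure and take a Urysohn
  function. Linear combinations and dominated limits give all integrable functions.\<close>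

lemma integrable_approx_continuous:
  fixes M :: "'a::euclidean_space measure" and h :: "'a \<Rightarrow> real"
  assumes fin: "finite_measure M" and S: "S \<in> sets borel"
    and sets: "sets M = sets (restrict_space borel S)"
    and h: "integrable M h" and "0 < e"
  shows "\<exists>g. continuous_on UNIV g \<and> integrable M g \<and> (\<integral>x. \<bar>g x - h x\<bar> \<partial>M) < e"
  using h \<open>0 < e\<close>
proof (induction arbitrary: e)
  interpret finite_measure M by fact
  have sp: "space M = S"
    using sets_eq_imp_space_eq[OF sets] by (simp add: space_restrict_space)
  have id [measurable]: "(\<lambda>x. x) \<in> measurable M borel"
    using sets by (simp cong: measurable_cong_sets add: measurable_restrict_space1)
  have sets_borel: "A \<in> sets borel" if "A \<in> sets M" for A
    using that S by (auto simp: sets sets_restrict_space)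
  \<comment> \<open>Regularity is a statement about Borel measures on the whole space, so the measure is
    pushed forward along the inclusion of \<open>S\<close>.\<close>
  let ?B = "distr M borel (\<lambda>x. x)"
  interpret B: finite_measure ?B by (rule finite_measure_distr) simp
  {
    case (base A c)
    \<comment> \<open>The summand 1 only serves to allow \<open>c = 0\<close>.\<close>
    define d where "d = e / (\<bar>c\<bar> + 1)"
    have d: "0 < d" using base by (simp add: d_def)
    have A: "A \<in> sets borel" "A \<subseteq> S"
      using base sets_borel sets.sets_into_space[of A M] sp by auto
    obtain K where K: "K \<subseteq> A" "compact K" "emeasure ?B A < emeasure ?B K + ennreal (d/2)"
    proof -
      have "emeasure ?B A = (SUP K \<in> {K. K \<subseteq> A \<and> compact K}. emeasure ?B K)"
        by (rule inner_regular) (use A in auto)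
      from SUP_approx_ennreal[OF _ _ this, of "d/2"] d
      obtain K where "K \<subseteq> A" "compact K" "emeasure ?B A < emeasure ?B K + ennreal (d/2)"
        by fastforce
      then show ?thesis by (rule that)
    qed
    obtain U where U: "A \<subseteq> U" "open U" "emeasure ?B U < emeasure ?B A + ennreal (d/2)"
    proof -
      have "emeasure ?B A = (INF U \<in> {U. A \<subseteq> U \<and> open U}. emeasure ?B U)"
        by (rule outer_regular) (use A in auto)
      from INF_approx_ennreal[OF _ this, of "d/2"] d
      obtain U where "A \<subseteq> U" "open U" "emeasure ?B U < emeasure ?B A + ennreal (d/2)"
        by fastforce
      then show ?thesis by (rule that)
    qed
    have KA: "measure ?B A < measure ?B K + d/2" and UA: "measure ?B U < measure ?B A + d/2"
      using K(3) U(3) d by (simp_all add: B.emeasure_eq_measure ennreal_less_iff flip: ennreal_plus)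
    have KU: "measure ?B (U - K) < d"
      using KA UA K U by (subst B.finite_measure_Diff) (auto simp: compact_imp_closed)
    obtain g :: "'a \<Rightarrow> real" where g: "continuous_on UNIV g" "\<And>x. g x \<in> closed_segment 0 1"
      "\<And>x. x \<in> - U \<Longrightarrow> g x = 0" "\<And>x. x \<in> K \<Longrightarrow> g x = 1"
      using Urysohn[of "-U" K 0 1] K U by (auto simp: compact_imp_closed)
    have g01: "0 \<le> g x" "g x \<le> 1" for x
      using g(2)[of x] by (auto simp: closed_segment_eq_real_ivl)
    have gm [measurable]: "g \<in> borel_measurable M"
      using measurable_comp[OF id borel_measurable_continuous_onI[OF g(1)]] by (simp add: o_def)
    have UM: "(U - K) \<inter> S \<in> sets M"
    proof -
      have "U - K \<in> sets borel" using K U by (simp add: compact_imp_closed borel_open borel_closed sets.Diff)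
      then show ?thesis unfolding sets sets_restrict_space by (auto simp: Int_commute)
    qed
    \<comment> \<open>Both functions are 1 on \<open>K\<close>, both vanish off \<open>U\<close>, and both lie in \<open>[0, 1]\<close>.\<close>
    have bound: "\<bar>g x - indicator A x\<bar> \<le> indicator ((U - K) \<inter> S) x" if "x \<in> space M" for x
      using g01[of x] g(3,4)[of x] K(1) U(1) that sp by (auto simp: indicator_def)
    have ig: "integrable M g"
      by (rule integrable_const_bound[of _ 1]) (use g01 in auto)
    have "(\<integral>x. \<bar>g x - indicator A x\<bar> \<partial>M) \<le> (\<integral>x. indicator ((U - K) \<inter> S) x \<partial>M)"
      using base bound UM ig by (intro integral_mono) (auto simp: emeasure_eq_measure)
    also have "\<dots> = measure ?B (U - K)"
      using UM K U by (subst measure_distr) (auto simp: compact_imp_closed sp Int_commute sets.Int_space_eq2)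
    finally have small: "(\<integral>x. \<bar>g x - indicator A x\<bar> \<partial>M) < d"
      using KU by simp
    have "(\<integral>x. \<bar>c * g x - indicator A x *\<^sub>R c\<bar> \<partial>M) = (\<integral>x. \<bar>c\<bar> * \<bar>g x - indicator A x\<bar> \<partial>M)"
      by (intro Bochner_Integration.integral_cong) (auto simp: abs_mult[symmetric] algebra_simps)
    also have "\<dots> \<le> \<bar>c\<bar> * d"
      using small by (simp add: mult_left_mono)
    also have "\<dots> < e"
      using base by (simp add: d_def field_simps)
    finally show ?case
      using g(1) ig by (intro exI[of _ "\<lambda>x. c * g x"]) (auto intro!: continuous_intros)
  next
    case (add u v)
    obtain g1 where g1: "continuous_on UNIV g1" "integrable M g1" "(\<integral>x. \<bar>g1 x - u x\<bar> \<partial>M) < e/2"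
      using add.IH(1)[of "e/2"] add.prems by auto
    obtain g2 where g2: "continuous_on UNIV g2" "integrable M g2" "(\<integral>x. \<bar>g2 x - v x\<bar> \<partial>M) < e/2"
      using add.IH(2)[of "e/2"] add.prems by auto
    have "(\<integral>x. \<bar>(g1 x + g2 x) - (u x + v x)\<bar> \<partial>M) \<le> (\<integral>x. \<bar>g1 x - u x\<bar> + \<bar>g2 x - v x\<bar> \<partial>M)"
      using g1 g2 add.hyps by (intro integral_mono) auto
    also have "\<dots> = (\<integral>x. \<bar>g1 x - u x\<bar> \<partial>M) + (\<integral>x. \<bar>g2 x - v x\<bar> \<partial>M)"
      using g1 g2 add.hyps by (intro Bochner_Integration.integral_add) auto
    also have "\<dots> < e" using g1 g2 by simp
    finally show ?case
      using g1 g2 by (intro exI[of _ "\<lambda>x. g1 x + g2 x"]) (auto intro!: continuous_intros)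
  next
    case (lim f s)
    have "(\<lambda>i. \<integral>x. \<bar>s i x - f x\<bar> \<partial>M) \<longlonglongrightarrow> (\<integral>x. 0 \<partial>M)"
    proof (rule integral_dominated_convergence[where w = "\<lambda>x. 3 * \<bar>f x\<bar>"])
      show "AE x in M. (\<lambda>i. \<bar>s i x - f x\<bar>) \<longlonglongrightarrow> 0"
        using lim.hyps(2) by (intro AE_I2) (auto intro!: tendsto_rabs_zero simp: LIM_zero_iff)
      show "AE x in M. norm \<bar>s i x - f x\<bar> \<le> 3 * \<bar>f x\<bar>" for i
        using lim.hyps(3)[of _ i] by (intro AE_I2) fastforce
    qed (use lim.hyps in auto)
    then have "(\<lambda>i. \<integral>x. \<bar>s i x - f x\<bar> \<partial>M) \<longlonglongrightarrow> 0" by simp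
    then obtain i where i: "(\<integral>x. \<bar>s i x - f x\<bar> \<partial>M) < e/2"
      using order_tendstoD(2)[of _ 0 sequentially "e/2"] lim.prems
      by (auto simp: eventually_sequentially)
    obtain g where g: "continuous_on UNIV g" "integrable M g" "(\<integral>x. \<bar>g x - s i x\<bar> \<partial>M) < e/2"
      using lim.IH[of "e/2" i] lim.prems by auto
    have "(\<integral>x. \<bar>g x - f x\<bar> \<partial>M) \<le> (\<integral>x. \<bar>g x - s i x\<bar> + \<bar>s i x - f x\<bar> \<partial>M)"
      using g lim.hyps by (intro integral_mono) auto
    also have "\<dots> = (\<integral>x. \<bar>g x - s i x\<bar> \<partial>M) + (\<integral>x. \<bar>s i x - f x\<bar> \<partial>M)"
      using g lim.hyps by (intro Bochner_Integration.integral_add) auto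
    also have "\<dots> < e" using g i by simp
    finally show ?case using g by blast
  }
qed

section \<open>Measures on the circle\<close>

lemma circle_measureD:
  assumes "circle_measure M"
  shows "finite_measure M" "sets M = sets circle" "space M = sphere 0 1"
  using assms sets_eq_imp_space_eq[of M circle]
  by (auto simp: circle_measure_def circle_def space_restrict_space)

lemma measurable_continuous_circle:
  fixes f :: "complex \<Rightarrow> 'b::topological_space"
  assumes "sets M = sets circle" "continuous_on (sphere 0 1) f"
  shows "f \<in> borel_measurable M"
  using borel_measurable_continuous_on_restrict[OF assms(2)] assms(1)
  by (simp add: circle_def cong: measurable_cong_sets)

lemma integrable_continuous_circle:
  fixes f :: "complex \<Rightarrow> real"
  assumes M: "circle_measure M" and f: "continuous_on (sphere 0 1) f"
  shows "integrable M f"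
proof -
  interpret finite_measure M using M by (rule circle_measureD)
  have "bounded (f ` sphere 0 1)"
    by (intro compact_imp_bounded compact_continuous_image f compact_sphere)
  then obtain B where "\<And>x. x \<in> sphere 0 1 \<Longrightarrow> norm (f x) \<le> B"
    unfolding bounded_iff by blast
  then show ?thesis
    using measurable_continuous_circle[OF circle_measureD(2)[OF M] f] circle_measureD(3)[OF M]
    by (intro integrable_const_bound[of _ B]) auto
qed

lemma simultaneous_continuous_approx_circle:
  fixes h :: "complex \<Rightarrow> real"
  assumes M: "circle_measure M" and N: "circle_measure N"
    and h: "h \<in> borel_measurable circle" "\<And>z. z \<in> sphere 0 1 \<Longrightarrow> \<bar>h z\<bar> \<le> B" and "0 < e"
  obtains g where "continuous_on UNIV g"
    "(\<integral>z. \<bar>g z - h z\<bar> \<partial>M) < e" "(\<integral>z. \<bar>g z - h z\<bar> \<partial>N) < e"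
proof -
  define L where "L = sup_measure' M N"
  note MN = circle_measureD[OF M] circle_measureD[OF N]
  have sets: "sets L = sets circle" and sp: "space L = sphere 0 1"
    using MN by (simp_all add: L_def)
  interpret finite_measure L
    unfolding L_def by (rule finite_measure_sup_measure') (use MN in auto)
  have hi: "integrable L h"
    using h sets sp by (intro integrable_const_bound[of _ B]) (auto cong: measurable_cong_sets)
  have S: "sphere (0::complex) 1 \<in> sets borel" by (intro borel_closed closed_sphere)
  obtain g where g: "continuous_on UNIV g" "integrable L g" "(\<integral>x. \<bar>g x - h x\<bar> \<partial>L) < e"
    using integrable_approx_continuous[OF finite_measure_axioms S sets[unfolded circle_def] hi \<open>0 < e\<close>]
    by blast
  have gh: "integrable L (\<lambda>x. \<bar>g x - h x\<bar>)"
    using g(2) hi by simp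
  have eq: "sets N = sets M" using MN by simp
  have le1: "emeasure M A \<le> emeasure L A" if "A \<in> sets M" for A
    using that unfolding L_def by (rule le_emeasure_sup_measure'1[OF eq])
  have le2: "emeasure N A \<le> emeasure L A" if "A \<in> sets N" for A
    using that unfolding L_def eq by (rule le_emeasure_sup_measure'2[OF eq])
  have "(\<integral>x. \<bar>g x - h x\<bar> \<partial>M) \<le> (\<integral>x. \<bar>g x - h x\<bar> \<partial>L)"
    by (rule integral_mono_measure(2)[OF _ le1 gh]) (simp_all add: sets MN)
  moreover have "(\<integral>x. \<bar>g x - h x\<bar> \<partial>N) \<le> (\<integral>x. \<bar>g x - h x\<bar> \<partial>L)"
    by (rule integral_mono_measure(2)[OF _ le2 gh]) (simp_all add: sets MN)
  ultimately show ?thesis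
    using that[OF g(1)] g(3) by linarith
qed

text \<open>Weak limits on the circle are unique: an indicator is approximated in \<open>L\<^sup>1\<close> of both measures by
  one continuous function, whose two integrals agree.\<close>

lemma circle_measure_eqI:
  assumes M: "circle_measure M" and N: "circle_measure N"
    and eq: "\<And>f :: complex \<Rightarrow> real. continuous_on (sphere 0 1) f \<Longrightarrow> (\<integral>z. f z \<partial>M) = (\<integral>z. f z \<partial>N)"
  shows "M = N"
proof (rule measure_eqI)
  note MN = circle_measureD[OF M] circle_measureD[OF N]
  interpret M: finite_measure M by (rule circle_measureD(1)[OF M])
  interpret N: finite_measure N by (rule circle_measureD(1)[OF N])
  show "sets M = sets N" by (simp only: MN)
  fix A assume A: "A \<in> sets M"
  have near: "\<bar>measure X A - (\<integral>z. g z \<partial>X)\<bar> \<le> (\<integral>z. \<bar>g z - indicator A z\<bar> \<partial>X)"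
    if X: "circle_measure X" and g: "continuous_on UNIV g" for X and g :: "complex \<Rightarrow> real"
  proof -
    interpret X: finite_measure X using X by (rule circle_measureD)
    have AX: "A \<in> sets X" using A by (simp only: MN circle_measureD[OF X])
    have gi: "integrable X g"
      using g by (intro integrable_continuous_circle[OF X]) (rule continuous_on_subset[OF _ subset_UNIV])
    have "\<bar>measure X A - (\<integral>z. g z \<partial>X)\<bar> = \<bar>\<integral>z. g z - indicator A z \<partial>X\<bar>"
      using AX gi by (subst Bochner_Integration.integral_diff) (auto simp: X.emeasure_eq_measure)
    also have "\<dots> \<le> (\<integral>z. \<bar>g z - indicator A z\<bar> \<partial>X)"
      by (rule integral_abs_bound)
    finally show ?thesis .
  qed
  have "\<bar>measure M A - measure N A\<bar> \<le> 0 + e" if "0 < e" for e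
  proof -
    have "(indicator A :: complex \<Rightarrow> real) \<in> borel_measurable circle"
      using A by (simp add: MN)
    moreover have "\<bar>indicator A z :: real\<bar> \<le> 1" for z
      by (simp add: indicator_def)
    moreover have "0 < e / 2" using that by simp
    ultimately obtain g :: "complex \<Rightarrow> real" where g: "continuous_on UNIV g"
      "(\<integral>z. \<bar>g z - indicator A z\<bar> \<partial>M) < e/2" "(\<integral>z. \<bar>g z - indicator A z\<bar> \<partial>N) < e/2"
      by (rule simultaneous_continuous_approx_circle[OF M N])
    moreover have "(\<integral>z. g z \<partial>M) = (\<integral>z. g z \<partial>N)"
      by (rule eq[OF continuous_on_subset[OF g(1) subset_UNIV]])
    ultimately show ?thesis
      using near[OF M g(1)] near[OF N g(1)] by linarith
  qed
  then have "\<bar>measure M A - measure N A\<bar> \<le> 0"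
    by (rule field_le_epsilon)
  then show "emeasure M A = emeasure N A"
    by (simp add: M.emeasure_eq_measure N.emeasure_eq_measure)
qed

section \<open>The Lebesgue decomposition\<close>

text \<open>Write \<open>\<tau>\<close> as \<open>g \<lambda>\<close> for a finite measure \<open>\<lambda>\<close> dominating both \<open>\<tau>\<close> and \<open>\<sigma>\<close>. The zero set \<open>S\<close> of \<open>g\<close>
  is \<open>\<tau>\<close>-null, and off \<open>S\<close> the measures \<open>\<tau>\<close> and \<open>\<lambda>\<close> have the same null sets, so there \<open>\<sigma>\<close> is
  absolutely continuous. This set carries the singular part of \<open>\<sigma>\<close>.\<close>

lemma ex_singular_carrier:
  assumes \<tau>: "finite_measure \<tau>" and \<sigma>: "finite_measure \<sigma>" and sets: "sets \<sigma> = sets \<tau>"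
  obtains S where "S \<in> null_sets \<tau>" "\<And>E. E \<in> null_sets \<tau> \<Longrightarrow> emeasure \<sigma> (E - S) = 0"
proof -
  define L where "L = sup_measure' \<tau> \<sigma>"
  interpret L: finite_measure L
    unfolding L_def by (rule finite_measure_sup_measure'[OF \<tau> \<sigma> sets])
  have sL: "sets L = sets \<tau>" unfolding L_def by (rule sets_sup_measure'[OF sets])
  have le1: "emeasure \<tau> A \<le> emeasure L A" if "A \<in> sets \<tau>" for A
    using that unfolding L_def by (rule le_emeasure_sup_measure'1[OF sets])
  have le2: "emeasure \<sigma> A \<le> emeasure L A" if "A \<in> sets \<tau>" for A
    using that unfolding L_def by (rule le_emeasure_sup_measure'2[OF sets])
  have "absolutely_continuous L \<tau>"
    using le1 sL by (auto simp: absolutely_continuous_def null_sets_def) (metis le_zero_eq)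
  then obtain g where g [measurable]: "g \<in> borel_measurable L" and Lg: "density L g = \<tau>"
    using L.Radon_Nikodym[of \<tau>] sL by metis
  define S where "S = {x \<in> space L. g x = 0}"
  have SL: "S \<in> sets L" unfolding S_def by measurable
  have "emeasure \<tau> S = (\<integral>\<^sup>+x. g x * indicator S x \<partial>L)"
    unfolding Lg[symmetric] by (rule emeasure_density[OF g SL])
  also have "\<dots> = (\<integral>\<^sup>+x. 0 \<partial>L)"
    by (intro nn_integral_cong) (auto simp: S_def indicator_def)
  finally have "S \<in> null_sets \<tau>"
    using SL sL by auto
  moreover have "emeasure \<sigma> (E - S) = 0" if E: "E \<in> null_sets \<tau>" for E
  proof -
    have EL: "E \<in> sets L" using E sL by auto
    have "(\<integral>\<^sup>+x. g x * indicator E x \<partial>L) = emeasure \<tau> E"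
      unfolding Lg[symmetric] by (rule emeasure_density[OF g EL, symmetric])
    also have "\<dots> = 0" using E by auto
    finally have "AE x in L. g x * indicator E x = 0"
      using EL by (subst (asm) nn_integral_0_iff_AE) auto
    then have "AE x in L. x \<notin> E - S"
      using AE_space by eventually_elim (auto simp: S_def indicator_def)
    moreover have "E - S = {x \<in> space L. \<not> x \<notin> E - S}"
      using sets.sets_into_space[OF EL] by auto
    ultimately have "emeasure L (E - S) = 0"
      using EL SL by (subst (asm) AE_iff_measurable[of "E - S"]) auto
    then show ?thesis
      using le2[of "E - S"] EL SL sL by simp
  qed
  ultimately show ?thesis by (rule that)
qed

text \<open>An absolutely continuous part is forced: removing from a set any \<open>\<tau>\<close>-null set that contains a
  carrier of the singular part does not change its \<open>\<sigma>a\<close>-measure, and what remains is measured alike by \<open>\<sigma>a\<close>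
  and \<open>\<sigma>\<close>. The freedom to
  enlarge the null set lets two decompositions be compared on a common one.\<close>

lemma lebesgue_decomposition_off_null_set:
  assumes "lebesgue_decomposition \<tau> \<sigma> \<sigma>a \<sigma>s"
  obtains A where "A \<in> null_sets \<tau>"
    "\<And>N E. N \<in> null_sets \<tau> \<Longrightarrow> A \<subseteq> N \<Longrightarrow> E \<in> sets \<tau> \<Longrightarrow> emeasure \<sigma>a E = emeasure \<sigma> (E - N)"
proof -
  from assms have sets: "sets \<sigma>a = sets \<tau>" "sets \<sigma>s = sets \<tau>"
    and ac: "absolutely_continuous \<tau> \<sigma>a" and sing: "mutually_singular \<tau> \<sigma>s"
    and sum: "\<And>A. A \<in> sets \<tau> \<Longrightarrow> emeasure \<sigma> A = emeasure \<sigma>a A + emeasure \<sigma>s A"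
    by (auto simp: lebesgue_decomposition_def)
  obtain A where A: "A \<in> null_sets \<tau>" "space \<tau> - A \<in> null_sets \<sigma>s"
    using sing by (auto simp: mutually_singular_def)
  have "emeasure \<sigma>a E = emeasure \<sigma> (E - N)"
    if N: "N \<in> null_sets \<tau>" "A \<subseteq> N" and E: "E \<in> sets \<tau>" for N E
  proof -
    have m: "E - N \<in> sets \<tau>" using N E by auto
    have "N \<in> null_sets \<sigma>a" using N ac by (auto simp: absolutely_continuous_def)
    then have "emeasure \<sigma>a E = emeasure \<sigma>a (E - N)"
      using E sets by (simp add: emeasure_Diff_null_set)
    moreover have "emeasure \<sigma>s (E - N) = 0"
    proof (rule emeasure_eq_0[OF _ null_setsD1[OF A(2)]])
      show "E - N \<subseteq> space \<tau> - A"
        using N sets.sets_into_space[OF E] by auto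
    qed (use A in auto)
    ultimately show ?thesis
      using sum[OF m] by simp
  qed
  with A(1) show ?thesis by (rule that)
qed

lemma lebesgue_decomposition_unique:
  assumes 1: "lebesgue_decomposition \<tau> \<sigma> \<sigma>a \<sigma>s" and 2: "lebesgue_decomposition \<tau> \<sigma> \<sigma>a' \<sigma>s'"
  shows "\<sigma>a = \<sigma>a'"
proof (rule measure_eqI)
  show "sets \<sigma>a = sets \<sigma>a'" using 1 2 by (simp add: lebesgue_decomposition_def)
  obtain A where A: "A \<in> null_sets \<tau>"
    "\<And>N E. N \<in> null_sets \<tau> \<Longrightarrow> A \<subseteq> N \<Longrightarrow> E \<in> sets \<tau> \<Longrightarrow> emeasure \<sigma>a E = emeasure \<sigma> (E - N)"
    by (rule lebesgue_decomposition_off_null_set[OF 1]) blast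
  obtain B where B: "B \<in> null_sets \<tau>"
    "\<And>N E. N \<in> null_sets \<tau> \<Longrightarrow> B \<subseteq> N \<Longrightarrow> E \<in> sets \<tau> \<Longrightarrow> emeasure \<sigma>a' E = emeasure \<sigma> (E - N)"
    by (rule lebesgue_decomposition_off_null_set[OF 2]) blast
  fix E assume "E \<in> sets \<sigma>a"
  then have E: "E \<in> sets \<tau>" using 1 by (simp add: lebesgue_decomposition_def)
  have AB: "A \<union> B \<in> null_sets \<tau>" using A(1) B(1) by auto
  show "emeasure \<sigma>a E = emeasure \<sigma>a' E"
    using A(2)[OF AB _ E] B(2)[OF AB _ E] by simp
qed

text \<open>This is the form in which the Lebesgue decomposition is used below: up to a \<open>\<tau>\<close>-null set \<open>S\<close>,
  \<open>ac_deriv \<tau> \<sigma>\<close> is a finite density of \<open>\<sigma>\<close>. It combines existence of the decomposition (the two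
  restrictions of \<open>\<sigma>\<close>) with its uniqueness, which identifies the definite description in
  \<open>ac_part\<close>.\<close>

lemma density_ac_deriv:
  assumes \<tau>: "finite_measure \<tau>" and \<sigma>: "finite_measure \<sigma>" and sets: "sets \<sigma> = sets \<tau>"
  obtains S where "S \<in> null_sets \<tau>"
    "density \<tau> (\<lambda>x. ennreal (ac_deriv \<tau> \<sigma> x)) = density \<sigma> (\<lambda>x. ennreal (indicator (space \<tau> - S) x))"
proof -
  interpret \<tau>: finite_measure \<tau> by fact
  interpret \<sigma>: finite_measure \<sigma> by fact
  obtain S where S: "S \<in> null_sets \<tau>" "\<And>E. E \<in> null_sets \<tau> \<Longrightarrow> emeasure \<sigma> (E - S) = 0"
    by (rule ex_singular_carrier[OF \<tau> \<sigma> sets]) blast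
  define \<sigma>a where "\<sigma>a = density \<sigma> (indicator (space \<tau> - S))"
  define \<sigma>s where "\<sigma>s = density \<sigma> (indicator S)"
  have sp: "space \<sigma> = space \<tau>" using sets by (rule sets_eq_imp_space_eq)
  have Sm: "S \<in> sets \<sigma>" "space \<tau> - S \<in> sets \<sigma>" using S(1) sets by auto
  have ea: "emeasure \<sigma>a E = emeasure \<sigma> (E - S)" if "E \<in> sets \<tau>" for E
  proof -
    have "emeasure \<sigma>a E = (\<integral>\<^sup>+x. indicator (space \<tau> - S) x * indicator E x \<partial>\<sigma>)"
      unfolding \<sigma>a_def using that Sm sets by (intro emeasure_density) auto
    also have "\<dots> = (\<integral>\<^sup>+x. indicator (E - S) x \<partial>\<sigma>)"
      using sets.sets_into_space[OF that] by (intro nn_integral_cong) (auto simp: indicator_def)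
    also have "\<dots> = emeasure \<sigma> (E - S)"
      using that Sm sets by (intro nn_integral_indicator) auto
    finally show ?thesis .
  qed
  have es: "emeasure \<sigma>s E = emeasure \<sigma> (E \<inter> S)" if "E \<in> sets \<tau>" for E
  proof -
    have "emeasure \<sigma>s E = (\<integral>\<^sup>+x. indicator S x * indicator E x \<partial>\<sigma>)"
      unfolding \<sigma>s_def using that Sm sets by (intro emeasure_density) auto
    also have "\<dots> = (\<integral>\<^sup>+x. indicator (E \<inter> S) x \<partial>\<sigma>)"
      by (intro nn_integral_cong) (auto simp: indicator_def)
    also have "\<dots> = emeasure \<sigma> (E \<inter> S)"
      using that Sm sets by (intro nn_integral_indicator) auto
    finally show ?thesis .
  qed
  have sa: "sets \<sigma>a = sets \<tau>" "sets \<sigma>s = sets \<tau>"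
    using sets by (simp_all add: \<sigma>a_def \<sigma>s_def)
  have ac: "absolutely_continuous \<tau> \<sigma>a"
    unfolding absolutely_continuous_def
  proof
    fix E assume E: "E \<in> null_sets \<tau>"
    then have "emeasure \<sigma>a E = 0" using S(2)[OF E] ea[of E] by (simp add: null_setsD2)
    then show "E \<in> null_sets \<sigma>a" using E sa by auto
  qed
  have "(space \<tau> - S) \<inter> S = {}" by auto
  then have "space \<tau> - S \<in> null_sets \<sigma>s"
    using es[of "space \<tau> - S"] Sm sets sa by (intro null_setsI) simp_all
  then have "mutually_singular \<tau> \<sigma>s"
    unfolding mutually_singular_def
    using S(1) by blast
  moreover have "emeasure \<sigma> E = emeasure \<sigma>a E + emeasure \<sigma>s E" if "E \<in> sets \<tau>" for E
  proof -
    have "emeasure \<sigma> (E - S) + emeasure \<sigma> (E \<inter> S) = emeasure \<sigma> ((E - S) \<union> (E \<inter> S))"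
      using that Sm sets by (intro plus_emeasure) auto
    also have "(E - S) \<union> (E \<inter> S) = E" by auto
    finally show ?thesis using ea[OF that] es[OF that] by simp
  qed
  ultimately have dec: "lebesgue_decomposition \<tau> \<sigma> \<sigma>a \<sigma>s"
    using ac sa by (simp add: lebesgue_decomposition_def)
  have part: "ac_part \<tau> \<sigma> = \<sigma>a"
    unfolding ac_part_def
    by (rule the_equality) (use dec lebesgue_decomposition_unique in blast)+
  have "finite_measure \<sigma>a"
    by (rule finite_measureI) (use ea[of "space \<tau>"] sa sets_eq_imp_space_eq[OF sa(1)] in simp)
  then have fin: "sigma_finite_measure \<sigma>a"
    by (rule finite_measure.axioms)
  have "AE x in \<tau>. ennreal (ac_deriv \<tau> \<sigma> x) = RN_deriv \<tau> \<sigma>a x"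
    using \<tau>.RN_deriv_finite[OF fin ac sa(1)]
    by eventually_elim (simp add: ac_deriv_def part top.not_eq_extremum)
  then have "density \<tau> (\<lambda>x. ennreal (ac_deriv \<tau> \<sigma> x)) = density \<tau> (RN_deriv \<tau> \<sigma>a)"
    by (intro density_cong) (auto simp: ac_deriv_def)
  also have "\<dots> = \<sigma>a"
    by (rule \<tau>.density_RN_deriv[OF ac sa(1)])
  also have "\<dots> = density \<sigma> (\<lambda>x. ennreal (indicator (space \<tau> - S) x))"
    unfolding \<sigma>a_def by (simp add: ennreal_indicator)
  finally show ?thesis
    by (rule that[OF S(1)])
qed

lemma ac_deriv_nonneg: "0 \<le> ac_deriv \<tau> \<sigma> x"
  by (simp add: ac_deriv_def)

lemma borel_measurable_ac_deriv [measurable]: "ac_deriv \<tau> \<sigma> \<in> borel_measurable \<tau>"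
  unfolding ac_deriv_def[abs_def] by measurable

text \<open>On the absolutely continuous part \<open>ac_deriv \<tau> \<sigma>\<close> is a genuine density, and the singular
  part of \<open>\<sigma>\<close> can only contribute a nonnegative amount; hence an inequality.\<close>

lemma
  fixes u :: "'a \<Rightarrow> real"
  assumes \<tau>: "finite_measure \<tau>" and \<sigma>: "finite_measure \<sigma>" and sets: "sets \<sigma> = sets \<tau>"
    and u: "integrable \<sigma> u" and nn: "\<And>x. 0 \<le> u x"
  shows integrable_ac_deriv_mult: "integrable \<tau> (\<lambda>x. ac_deriv \<tau> \<sigma> x * u x)"
    and integral_ac_deriv_mult_le: "(\<integral>x. ac_deriv \<tau> \<sigma> x * u x \<partial>\<tau>) \<le> (\<integral>x. u x \<partial>\<sigma>)"
proof -
  obtain S where S: "S \<in> null_sets \<tau>"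
    "density \<tau> (\<lambda>x. ennreal (ac_deriv \<tau> \<sigma> x)) = density \<sigma> (\<lambda>x. ennreal (indicator (space \<tau> - S) x))"
    (is "?D = ?E") by (rule density_ac_deriv[OF \<tau> \<sigma> sets])
  have Sm: "space \<tau> - S \<in> sets \<sigma>" using S(1) sets by auto
  have u\<sigma>: "u \<in> borel_measurable \<sigma>" using u by auto
  then have u\<tau>: "u \<in> borel_measurable \<tau>" using sets by (simp cong: measurable_cong_sets)
  have restr: "integrable \<sigma> (\<lambda>x. indicator (space \<tau> - S) x *\<^sub>R u x)"
    by (rule integrable_mult_indicator[OF Sm u])
  have "integrable ?E u"
    using Sm u\<sigma> restr by (subst integrable_density) auto
  then have "integrable ?D u" by (simp only: S(2))
  then show "integrable \<tau> (\<lambda>x. ac_deriv \<tau> \<sigma> x * u x)"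
    using u\<tau> by (subst (asm) integrable_density) (auto simp: ac_deriv_nonneg)
  have "(\<integral>x. ac_deriv \<tau> \<sigma> x * u x \<partial>\<tau>) = (\<integral>x. u x \<partial>?D)"
    using u\<tau> by (subst integral_density) (auto simp: ac_deriv_nonneg)
  also have "\<dots> = (\<integral>x. u x \<partial>?E)" by (simp only: S(2))
  also have "\<dots> = (\<integral>x. indicator (space \<tau> - S) x *\<^sub>R u x \<partial>\<sigma>)"
    using Sm u\<sigma> by (subst integral_density) auto
  also have "\<dots> \<le> (\<integral>x. u x \<partial>\<sigma>)"
    by (intro integral_mono restr u) (auto simp: indicator_def nn)
  finally show "(\<integral>x. ac_deriv \<tau> \<sigma> x * u x \<partial>\<tau>) \<le> (\<integral>x. u x \<partial>\<sigma>)" .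
qed

lemma
  assumes \<tau>: "finite_measure \<tau>" and \<sigma>: "finite_measure \<sigma>" and sets: "sets \<sigma> = sets \<tau>"
  shows integrable_ac_deriv: "integrable \<tau> (ac_deriv \<tau> \<sigma>)"
    and integrable_sqrt_ac_deriv: "integrable \<tau> (\<lambda>x. sqrt (ac_deriv \<tau> \<sigma> x))"
proof -
  interpret \<tau>: finite_measure \<tau> by fact
  interpret \<sigma>: finite_measure \<sigma> by fact
  show int: "integrable \<tau> (ac_deriv \<tau> \<sigma>)"
    using integrable_ac_deriv_mult[OF \<tau> \<sigma> sets, of "\<lambda>_. 1"] by simp
  have "sqrt y \<le> 1 + y" if "0 \<le> y" for y :: real
    using that by (intro real_le_lsqrt) (auto simp: power2_eq_square algebra_simps)
  then have le: "norm (sqrt (ac_deriv \<tau> \<sigma> x)) \<le> norm (1 + ac_deriv \<tau> \<sigma> x)" for x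
    using ac_deriv_nonneg[of \<tau> \<sigma> x] by simp
  have "integrable \<tau> (\<lambda>x. 1 + ac_deriv \<tau> \<sigma> x)" by (simp add: int)
  then show "integrable \<tau> (\<lambda>x. sqrt (ac_deriv \<tau> \<sigma> x))"
    by (rule Bochner_Integration.integrable_bound) (measurable, rule AE_I2, rule le)
qed

section \<open>The Hellinger affinity as an infimum over continuous functions\<close>

text \<open>For \<open>w = y\<close> the left-hand side, which is \<open>(y - w)\<^sup>2 / w\<close>, vanishes. Clamping \<open>y\<close> to \<open>[t, 1/t]\<close>
  keeps the weight \<open>1/w\<close> bounded at the price of an error that tends to 0 with \<open>t\<close> and is
  integrable when \<open>y\<^sup>2\<close> is.\<close>

lemma clamp_quadratic_defect:
  fixes y t :: real
  assumes "0 < t" "t < 1" "0 \<le> y"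
  defines "w \<equiv> max t (min y (1/t))"
  shows "y\<^sup>2 * (1/w) + w - 2 * y \<le> t * (1 + y\<^sup>2)"
proof -
  have t1: "t < 1/t" using assms mult_strict_mono[of t 1 t 1] by (simp add: field_simps)
  consider "y < t" | "t \<le> y" "y \<le> 1/t" | "1/t < y" by linarith
  then show ?thesis
  proof cases
    case 1
    then have w: "w = t" using t1 by (simp add: w_def)
    have "y\<^sup>2 * (1/t) \<le> y"
      using 1 assms mult_right_mono[of y t y] by (simp add: power2_eq_square field_simps)
    moreover have "0 \<le> t * y\<^sup>2" using assms by simp
    ultimately have "y\<^sup>2 * (1/t) + t - 2 * y \<le> t + t * y\<^sup>2"
      using assms(3) by linarith
    then show ?thesis by (simp add: w distrib_left)
  next
    case 2
    then have "w = y" "0 < y" using assms t1 by (auto simp: w_def)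
    then show ?thesis using assms by (simp add: power2_eq_square)
  next
    case 3
    then have "w = 1/t" using t1 by (simp add: w_def)
    then show ?thesis using assms 3 by (simp add: algebra_simps)
  qed
qed

text \<open>Let \<open>\<mu> = M\<close> and \<open>\<nu> = N\<close>. For every positive weight \<open>h\<close> the arithmetic-geometric mean inequality gives
  \<open>h d\<mu> + (1/h) d\<nu> \<ge> 2 sqrt (d\<mu> d\<nu>)\<close>, and the Hellinger affinity \<open>\<integral> sqrt (d\<mu>/d\<nu>) d\<nu>\<close> is half the
  infimum of the total masses on the left. The formal minimizer is \<open>sqrt (d\<nu>/d\<mu>)\<close>; it is clamped to
  a compact subinterval of the positive reals, made small on a carrier of the singular part of
  \<open>\<mu>\<close>, and then replaced by a continuous function. Continuity of \<open>h\<close> is what makes the bound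
  usable with weak convergence.\<close>

lemma approx_affinity:
  assumes M: "circle_measure M" and N: "circle_measure N" and "0 < e"
  obtains h :: "complex \<Rightarrow> real" where "continuous_on UNIV h" "\<And>z. 0 < h z"
    "(\<integral>z. h z \<partial>M) + (\<integral>z. 1 / h z \<partial>N) < 2 * (\<integral>z. sqrt (ac_deriv N M z) \<partial>N) + e"
proof -
  note MN = circle_measureD[OF M] circle_measureD[OF N]
  interpret M: finite_measure M by (rule circle_measureD(1)[OF M])
  interpret N: finite_measure N by (rule circle_measureD(1)[OF N])
  have eq: "sets M = sets N" by (simp only: MN)
  let ?c = "ac_deriv N M"
  obtain S where S: "S \<in> null_sets N"
    "density N (\<lambda>x. ennreal (?c x)) = density M (\<lambda>x. ennreal (indicator (space N - S) x))"
    by (rule density_ac_deriv[OF N.finite_measure_axioms M.finite_measure_axioms eq])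
  have SN: "S \<in> sets N" and SM: "S \<in> sets M" "space N - S \<in> sets M" using S(1) eq by auto
  define C where "C = measure M S + (\<integral>z. 1 + ?c z \<partial>N)"
  have ic: "integrable N ?c" and isq: "integrable N (\<lambda>z. sqrt (?c z))"
    by (rule integrable_ac_deriv integrable_sqrt_ac_deriv N.finite_measure_axioms M.finite_measure_axioms eq)+
  have C: "0 \<le> C"
    unfolding C_def by (intro add_nonneg_nonneg integral_nonneg) (auto simp: ac_deriv_nonneg)
  \<comment> \<open>Clamping may cost \<open>e / 2\<close>, which leaves \<open>e / 4\<close> for each of the two integrals when the weight is
    made continuous. The bound \<open>1/2\<close> ensures \<open>t < 1 / t\<close>.\<close>
  define t where "t = min (1/2) (e / (2 * (C + 1)))"
  have t: "0 < t" "t < 1" "t * C < e / 2"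
  proof -
    show "0 < t" "t < 1" using \<open>0 < e\<close> C by (auto simp: t_def)
    have "t * C \<le> e / (2 * (C + 1)) * C"
      using C by (intro mult_right_mono) (auto simp: t_def)
    also have "\<dots> < e / 2" using C \<open>0 < e\<close> by (simp add: field_simps)
    finally show "t * C < e / 2" .
  qed
  have tt: "t < 1 / t" using t mult_strict_mono[of t 1 t 1] by (simp add: field_simps)
  define w where "w z = max t (min (sqrt (?c z)) (1/t))" for z
  \<comment> \<open>The measurable weight; its value on \<open>S\<close> is invisible to \<open>N\<close> and must only be small for \<open>M\<close>.\<close>
  define k where "k z = (if z \<in> S then t else 1 / w z)" for z
  have w: "t \<le> w z" "w z \<le> 1 / t" "0 < w z" for z
    using t tt by (auto simp: w_def)
  have kb: "t \<le> k z" "k z \<le> 1 / t" "0 < k z" for z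
  proof -
    show "t \<le> k z" using w[of z] t by (auto simp: k_def field_simps)
    then show "0 < k z" using t by simp
    show "k z \<le> 1 / t" using w[of z] t tt by (auto simp: k_def field_simps)
  qed
  have kN [measurable]: "k \<in> borel_measurable N"
    unfolding k_def[abs_def] w_def[abs_def] using SN by measurable
  have kM [measurable]: "k \<in> borel_measurable M"
    using kN eq by (simp cong: measurable_cong_sets)
  have kc: "k \<in> borel_measurable circle"
    using kN MN(5) by (simp cong: measurable_cong_sets)
  have ikM: "integrable M k"
    by (rule M.integrable_const_bound[of _ "1/t"]) (use kb in \<open>auto simp: abs_of_pos\<close>)
  have ikN: "integrable N (\<lambda>z. 1 / k z)"
    by (rule N.integrable_const_bound[of _ "1/t"]) (use kb t in \<open>auto simp: abs_of_pos field_simps\<close>)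
  have dom: "integrable N (\<lambda>z. ?c z * k z)"
    by (rule integrable_ac_deriv_mult[OF N.finite_measure_axioms M.finite_measure_axioms eq ikM])
       (simp add: less_imp_le kb)
  have "(\<integral>z. k z \<partial>M) = (\<integral>z. indicator S z *\<^sub>R k z + indicator (space N - S) z *\<^sub>R k z \<partial>M)"
    using MN by (intro Bochner_Integration.integral_cong) (auto simp: indicator_def)
  also have "\<dots> = (\<integral>z. indicator S z *\<^sub>R k z \<partial>M) + (\<integral>z. indicator (space N - S) z *\<^sub>R k z \<partial>M)"
    by (intro Bochner_Integration.integral_add integrable_mult_indicator SM ikM)
  also have "(\<integral>z. indicator S z *\<^sub>R k z \<partial>M) = (\<integral>z. t * indicator S z \<partial>M)"
    by (intro Bochner_Integration.integral_cong) (auto simp: indicator_def k_def)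
  also have "\<dots> = t * measure M S"
    using SM by simp
  also have "(\<integral>z. indicator (space N - S) z *\<^sub>R k z \<partial>M)
      = (\<integral>z. k z \<partial>density M (\<lambda>x. ennreal (indicator (space N - S) x)))"
    using SM kM by (subst integral_density) auto
  also have "\<dots> = (\<integral>z. k z \<partial>density N (\<lambda>x. ennreal (?c x)))"
    by (simp only: S(2))
  also have "\<dots> = (\<integral>z. ?c z * k z \<partial>N)"
    using kN by (subst integral_density) (auto simp: ac_deriv_nonneg)
  finally have split: "(\<integral>z. k z \<partial>M) = t * measure M S + (\<integral>z. ?c z * k z \<partial>N)" .
  have "(\<integral>z. ?c z * k z \<partial>N) + (\<integral>z. 1 / k z \<partial>N) = (\<integral>z. ?c z * k z + 1 / k z \<partial>N)"
    using dom ikN by (simp add: Bochner_Integration.integral_add)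
  also have "\<dots> \<le> (\<integral>z. 2 * sqrt (?c z) + t * (1 + ?c z) \<partial>N)"
  proof (rule integral_mono_AE)
    show "AE z in N. ?c z * k z + 1 / k z \<le> 2 * sqrt (?c z) + t * (1 + ?c z)"
      using AE_not_in[OF S(1)]
    proof eventually_elim
      case (elim z)
      then show ?case
        using clamp_quadratic_defect[OF t(1,2), of "sqrt (?c z)"]
        by (simp add: k_def w_def ac_deriv_nonneg)
    qed
  qed (use dom ikN ic isq in auto)
  also have "\<dots> = 2 * (\<integral>z. sqrt (?c z) \<partial>N) + t * (\<integral>z. 1 + ?c z \<partial>N)"
    using ic isq by (subst Bochner_Integration.integral_add) auto
  finally have k: "(\<integral>z. k z \<partial>M) + (\<integral>z. 1 / k z \<partial>N) \<le> 2 * (\<integral>z. sqrt (?c z) \<partial>N) + t * C"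
    unfolding split C_def by (simp add: algebra_simps)
  \<comment> \<open>On \<open>[t, 1/t]\<close> the reciprocal is Lipschitz with constant \<open>1 / t\<^sup>2\<close>, whence the factor \<open>t\<^sup>2\<close>.\<close>
  define d where "d = e * t\<^sup>2 / 4"
  have d: "0 < d" using \<open>0 < e\<close> t by (simp add: d_def)
  have "\<bar>k z\<bar> \<le> 1 / t" for z using kb[of z] by (simp add: abs_of_pos)
  from simultaneous_continuous_approx_circle[OF M N kc this d]
  obtain g where g: "continuous_on UNIV g"
    "(\<integral>z. \<bar>g z - k z\<bar> \<partial>M) < d" "(\<integral>z. \<bar>g z - k z\<bar> \<partial>N) < d" by blast
  define h where "h z = max t (min (g z) (1/t))" for z
  have hb: "t \<le> h z" "h z \<le> 1 / t" "0 < h z" for z using t tt by (auto simp: h_def)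
  have hc: "continuous_on UNIV h" unfolding h_def[abs_def] by (intro continuous_intros g)
  have gc: "continuous_on (sphere 0 1) g" by (rule continuous_on_subset[OF g(1) subset_UNIV])
  have hcs: "continuous_on (sphere 0 1) h" by (rule continuous_on_subset[OF hc subset_UNIV])
  have hcs': "continuous_on (sphere 0 1) (\<lambda>z. 1 / h z)"
    using hb(3) by (intro continuous_intros hcs) (auto simp: less_imp_neq[symmetric])
  note int = integrable_continuous_circle[OF M] integrable_continuous_circle[OF N]
  have ikN': "integrable N k"
    by (rule N.integrable_const_bound[of _ "1/t"]) (use kb in \<open>auto simp: abs_of_pos\<close>)
  have near: "\<bar>h z - k z\<bar> \<le> \<bar>g z - k z\<bar>" for z
    using kb[of z] by (auto simp: h_def)
  have near': "1 / h z - 1 / k z \<le> \<bar>g z - k z\<bar> / t\<^sup>2" for z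
  proof -
    have "1 / h z - 1 / k z = (k z - h z) / (h z * k z)"
      using hb[of z] kb[of z] by (simp add: field_simps)
    also have "\<dots> \<le> \<bar>g z - k z\<bar> / (h z * k z)"
      using near[of z] hb[of z] kb[of z] by (intro divide_right_mono) auto
    also have "\<dots> \<le> \<bar>g z - k z\<bar> / t\<^sup>2"
      using hb[of z] kb[of z] t unfolding power2_eq_square
      by (intro divide_left_mono mult_mono) auto
    finally show ?thesis .
  qed
  have "(\<integral>z. h z \<partial>M) \<le> (\<integral>z. k z + \<bar>g z - k z\<bar> \<partial>M)"
  proof (rule integral_mono)
    show "h z \<le> k z + \<bar>g z - k z\<bar>" for z using near[of z] by simp
  qed (intro int hcs Bochner_Integration.integrable_add ikM integrable_abs
      Bochner_Integration.integrable_diff gc)+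
  also have "\<dots> = (\<integral>z. k z \<partial>M) + (\<integral>z. \<bar>g z - k z\<bar> \<partial>M)"
    by (intro Bochner_Integration.integral_add ikM integrable_abs Bochner_Integration.integrable_diff int gc)
  also have "\<dots> \<le> (\<integral>z. k z \<partial>M) + e / 4"
  proof -
    have "d \<le> e * 1 / 4" unfolding d_def using t \<open>0 < e\<close>
      by (intro divide_right_mono mult_left_mono) (auto simp: power_le_one)
    then show ?thesis using g(2) by simp
  qed
  finally have 1: "(\<integral>z. h z \<partial>M) \<le> (\<integral>z. k z \<partial>M) + e / 4" .
  have ig: "integrable N (\<lambda>z. \<bar>g z - k z\<bar> / t\<^sup>2)"
    by (intro integrable_divide integrable_abs Bochner_Integration.integrable_diff int gc ikN')
  have "(\<integral>z. 1 / h z \<partial>N) \<le> (\<integral>z. 1 / k z + \<bar>g z - k z\<bar> / t\<^sup>2 \<partial>N)"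
  proof (rule integral_mono)
    show "1 / h z \<le> 1 / k z + \<bar>g z - k z\<bar> / t\<^sup>2" for z using near'[of z] by simp
  qed (intro int hcs' Bochner_Integration.integrable_add ikN ig)+
  also have "\<dots> = (\<integral>z. 1 / k z \<partial>N) + (\<integral>z. \<bar>g z - k z\<bar> / t\<^sup>2 \<partial>N)"
    by (intro Bochner_Integration.integral_add ikN ig)
  also have "(\<integral>z. \<bar>g z - k z\<bar> / t\<^sup>2 \<partial>N) = (\<integral>z. \<bar>g z - k z\<bar> \<partial>N) / t\<^sup>2"
    by simp
  also have "\<dots> \<le> e / 4"
    using g(3) t by (simp add: d_def field_simps)
  finally have 2: "(\<integral>z. 1 / h z \<partial>N) \<le> (\<integral>z. 1 / k z \<partial>N) + e / 4" by simp
  show ?thesis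
    by (rule that[OF hc hb(3)]) (use 1 2 k t(3) in linarith)
qed

section \<open>Factoring a generalized Riesz product\<close>

lemma sq_prod_nonneg: "0 \<le> sq_prod P I z"
  unfolding sq_prod_def by (intro prod_nonneg) auto

lemma continuous_on_sq_prod: "continuous_on A (sq_prod P I)"
  unfolding sq_prod_def[abs_def] by (intro continuous_intros)

lemma sq_prod_split: "sq_prod P {1..n + k} z = sq_prod P {1..n} z * sq_prod P {n+1..n+k} z"
  unfolding sq_prod_def by (rule prod.ub_add_nat) simp

lemma circle_measure_density:
  assumes M: "circle_measure M" and p: "continuous_on (sphere 0 1) p" "\<And>z. 0 \<le> p z"
  shows "circle_measure (density M (\<lambda>z. ennreal (p z)))"
proof -
  have pm: "p \<in> borel_measurable M"
    by (rule measurable_continuous_circle[OF circle_measureD(2)[OF M] p(1)])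
  have "emeasure (density M (\<lambda>z. ennreal (p z))) (space M) = (\<integral>\<^sup>+z. ennreal (p z) * indicator (space M) z \<partial>M)"
    using pm by (intro emeasure_density) auto
  also have "\<dots> = (\<integral>\<^sup>+z. ennreal (p z) \<partial>M)"
    by (intro nn_integral_cong) auto
  also have "\<dots> = ennreal (\<integral>z. p z \<partial>M)"
    using p integrable_continuous_circle[OF M p(1)] by (intro nn_integral_eq_integral) auto
  finally have "finite_measure (density M (\<lambda>z. ennreal (p z)))"
    by (intro finite_measureI) simp
  then show ?thesis
    using circle_measureD(2)[OF M] by (simp add: circle_measure_def)
qed

lemma integral_density_continuous:
  fixes f p :: "complex \<Rightarrow> real"
  assumes "sets M = sets circle" "continuous_on (sphere 0 1) p" "\<And>z. 0 \<le> p z"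
    "continuous_on (sphere 0 1) f"
  shows "(\<integral>z. f z \<partial>density M (\<lambda>z. ennreal (p z))) = (\<integral>z. p z * f z \<partial>M)"
  using measurable_continuous_circle[OF assms(1,2)] measurable_continuous_circle[OF assms(1,4)] assms(3)
  by (subst integral_density) auto

text \<open>The first \<open>n\<close> factors are continuous, so they may be pulled out of the weak limit.\<close>

lemma tail_product_factorization:
  assumes "is_tail_product P 0 M" and "is_tail_product P n N"
  shows "M = density N (\<lambda>z. ennreal (sq_prod P {1..n} z))"
proof (rule circle_measure_eqI)
  let ?L = "\<lambda>n k. density circle_lebesgue (\<lambda>z. ennreal (sq_prod P {n+1..n+k} z))"
  have wM: "weak_limit (?L 0) M" and wN: "weak_limit (?L n) N"
    using assms by (simp_all add: is_tail_product_def)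
  show M: "circle_measure M" using wM by (simp add: weak_limit_def)
  have N: "circle_measure N" using wN by (simp add: weak_limit_def)
  show "circle_measure (density N (\<lambda>z. ennreal (sq_prod P {1..n} z)))"
    by (rule circle_measure_density[OF N continuous_on_sq_prod sq_prod_nonneg])
  fix f :: "complex \<Rightarrow> real" assume f: "continuous_on (sphere 0 1) f"
  have sL: "sets circle_lebesgue = sets circle"
    by (simp add: circle_lebesgue_def)
  have pf: "continuous_on (sphere 0 1) (\<lambda>z. sq_prod P {1..n} z * f z)"
    by (intro continuous_intros continuous_on_sq_prod f)
  have shift: "(\<integral>z. f z \<partial>?L 0 (k + n)) = (\<integral>z. sq_prod P {1..n} z * f z \<partial>?L n k)" for k
  proof -
    have "(\<integral>z. f z \<partial>?L 0 (k + n)) = (\<integral>z. sq_prod P {0+1..0+(k+n)} z * f z \<partial>circle_lebesgue)"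
      by (rule integral_density_continuous[OF sL continuous_on_sq_prod sq_prod_nonneg f])
    also have "\<dots> = (\<integral>z. sq_prod P {n+1..n+k} z * (sq_prod P {1..n} z * f z) \<partial>circle_lebesgue)"
      using sq_prod_split[of P n k] by (simp add: add.commute mult_ac)
    also have "\<dots> = (\<integral>z. sq_prod P {1..n} z * f z \<partial>?L n k)"
      by (rule integral_density_continuous[OF sL continuous_on_sq_prod sq_prod_nonneg pf, symmetric])
    finally show ?thesis .
  qed
  have "(\<lambda>k. \<integral>z. f z \<partial>?L 0 k) \<longlonglongrightarrow> (\<integral>z. f z \<partial>M)"
    using wM f unfolding weak_limit_def by blast
  then have "(\<lambda>k. \<integral>z. f z \<partial>?L 0 (k + n)) \<longlonglongrightarrow> (\<integral>z. f z \<partial>M)"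
    by (rule LIMSEQ_ignore_initial_segment)
  moreover have "(\<lambda>k. \<integral>z. sq_prod P {1..n} z * f z \<partial>?L n k) \<longlonglongrightarrow> (\<integral>z. sq_prod P {1..n} z * f z \<partial>N)"
    using wN pf unfolding weak_limit_def by blast
  ultimately have "(\<integral>z. f z \<partial>M) = (\<integral>z. sq_prod P {1..n} z * f z \<partial>N)"
    unfolding shift by (rule LIMSEQ_unique)
  then show "(\<integral>z. f z \<partial>M) = (\<integral>z. f z \<partial>density N (\<lambda>z. ennreal (sq_prod P {1..n} z)))"
    by (simp add: integral_density_continuous[OF circle_measureD(2)[OF N] continuous_on_sq_prod sq_prod_nonneg f])
qed

section \<open>Comparing two products\<close>

text \<open>Integrate \<open>2 sqrt (q/p) \<le> (q/p) h + 1/h\<close> against \<open>p dN\<close>. Where \<open>p\<close> vanishes the quotient is 0 by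
  convention, so cancelling \<open>p\<close> loses the part of \<open>q h dN\<close> living there and leaves an inequality.\<close>

lemma
  fixes p q h :: "complex \<Rightarrow> real"
  assumes N: "circle_measure N"
    and cont: "continuous_on (sphere 0 1) p" "continuous_on (sphere 0 1) q" "continuous_on (sphere 0 1) h"
    and nn: "\<And>z. 0 \<le> p z" "\<And>z. 0 \<le> q z" and pos: "\<And>z. 0 < h z"
    and M: "M = density N (\<lambda>z. ennreal (p z))"
  shows integrable_sqrt_ratio: "integrable M (\<lambda>z. sqrt (q z / p z))"
    and integral_sqrt_ratio_le:
      "2 * (\<integral>z. sqrt (q z / p z) \<partial>M) \<le> (\<integral>z. q z * h z \<partial>N) + (\<integral>z. 1 / h z \<partial>M)"
proof -
  have cM: "circle_measure M"
    unfolding M by (rule circle_measure_density[OF N cont(1) nn(1)])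
  note sN = circle_measureD(2)[OF N] and sM = circle_measureD(2)[OF cM]
  note meas = cont[THEN measurable_continuous_circle[OF sN]] cont[THEN measurable_continuous_circle[OF sM]]
  have cinv: "continuous_on (sphere 0 1) (\<lambda>z. 1 / h z)"
    using pos by (intro continuous_intros cont) (auto simp: less_imp_neq[symmetric])
  have inv: "integrable M (\<lambda>z. 1 / h z)"
    by (rule integrable_continuous_circle[OF cM cinv])
  have qh: "integrable N (\<lambda>z. q z * h z)"
    by (intro integrable_continuous_circle[OF N] continuous_intros cont)
  have le: "p z * (q z / p z * h z) \<le> q z * h z" "0 \<le> q z / p z * h z" for z
    using nn[of z] pos[of z] by auto
  have norm_le: "norm (p z * (q z / p z * h z)) \<le> norm (q z * h z)" for z
  proof -
    have "0 \<le> p z * (q z / p z * h z)" by (intro mult_nonneg_nonneg nn le)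
    with le(1)[of z] show ?thesis unfolding real_norm_def by linarith
  qed
  have bd: "integrable N (\<lambda>z. p z * (q z / p z * h z))"
    by (rule Bochner_Integration.integrable_bound[OF qh])
       (intro borel_measurable_times borel_measurable_divide meas, rule AE_I2, rule norm_le)
  then have ratio: "integrable M (\<lambda>z. q z / p z * h z)"
    unfolding M using meas by (subst integrable_density) (auto simp: nn)
  have "(\<integral>z. q z / p z * h z \<partial>M) = (\<integral>z. p z * (q z / p z * h z) \<partial>N)"
    unfolding M using meas by (subst integral_density) (auto simp: nn)
  also have "\<dots> \<le> (\<integral>z. q z * h z \<partial>N)"
    by (intro integral_mono bd qh le)
  finally have ratio_le: "(\<integral>z. q z / p z * h z \<partial>M) \<le> (\<integral>z. q z * h z \<partial>N)" .
  have amgm: "2 * sqrt (q z / p z) \<le> q z / p z * h z + 1 / h z" for z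
  proof -
    define y where "y = sqrt (q z / p z)"
    have y: "q z / p z = y\<^sup>2" using nn[of z] by (simp add: y_def)
    have "y\<^sup>2 * h z + 1 / h z - 2 * y = (y * h z - 1)\<^sup>2 / h z"
      using pos[of z] by (simp add: power2_eq_square field_simps)
    also have "\<dots> \<ge> 0" using pos[of z] by simp
    finally have "2 * y \<le> y\<^sup>2 * h z + 1 / h z" by simp
    then show ?thesis unfolding y[symmetric] unfolding y_def .
  qed
  have sum: "integrable M (\<lambda>z. q z / p z * h z + 1 / h z)"
    by (intro Bochner_Integration.integrable_add ratio inv)
  have bound: "norm (sqrt (q z / p z)) \<le> norm (q z / p z * h z + 1 / h z)" for z
  proof -
    have "0 \<le> sqrt (q z / p z)" using nn by simp
    with amgm[of z] show ?thesis unfolding real_norm_def by linarith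
  qed
  show int: "integrable M (\<lambda>z. sqrt (q z / p z))"
    by (rule Bochner_Integration.integrable_bound[OF sum]) 
       (intro measurable_compose[OF _ borel_measurable_sqrt] borel_measurable_divide meas, rule AE_I2, rule bound)
  have "2 * (\<integral>z. sqrt (q z / p z) \<partial>M) = (\<integral>z. 2 * sqrt (q z / p z) \<partial>M)" by simp
  also have "\<dots> \<le> (\<integral>z. q z / p z * h z + 1 / h z \<partial>M)"
    by (intro integral_mono amgm sum integrable_mult_right int)
  also have "\<dots> = (\<integral>z. q z / p z * h z \<partial>M) + (\<integral>z. 1 / h z \<partial>M)"
    by (intro Bochner_Integration.integral_add ratio inv)
  finally show "2 * (\<integral>z. sqrt (q z / p z) \<partial>M) \<le> (\<integral>z. q z * h z \<partial>N) + (\<integral>z. 1 / h z \<partial>M)"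
    using ratio_le by simp
qed

text \<open>The density of \<open>\<sigma>\<close> lives where \<open>\<sigma>\<close> does. This will show that the density vanishes at the zeros
  of the finite \<open>P\<close>-products.\<close>

lemma AE_ac_deriv:
  assumes \<tau>: "finite_measure \<tau>" and \<sigma>: "finite_measure \<sigma>" and sets: "sets \<sigma> = sets \<tau>"
    and ae: "AE x in \<sigma>. A x"
  shows "AE x in \<tau>. ac_deriv \<tau> \<sigma> x \<noteq> 0 \<longrightarrow> A x"
proof -
  obtain S where S: "S \<in> null_sets \<tau>"
    "density \<tau> (\<lambda>x. ennreal (ac_deriv \<tau> \<sigma> x)) = density \<sigma> (\<lambda>x. ennreal (indicator (space \<tau> - S) x))"
    (is "?D = ?E") by (rule density_ac_deriv[OF \<tau> \<sigma> sets])
  have "space \<tau> - S \<in> sets \<sigma>" using S(1) sets by auto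
  then have "AE x in ?E. A x"
    using ae by (subst AE_density) auto
  then have "AE x in ?D. A x" by (simp only: S(2))
  then have "AE x in \<tau>. 0 < ennreal (ac_deriv \<tau> \<sigma> x) \<longrightarrow> A x"
    by (subst (asm) AE_density) auto
  then show ?thesis
    by eventually_elim (metis ac_deriv_nonneg ennreal_less_zero_iff order_le_less)
qed

text \<open>The expression divided by \<open>t\<close> is \<open>(R - y)\<^sup>2 / R\<close>. The parameter \<open>t\<close> replaces an appeal to the Cauchy-Schwarz
  inequality \<open>(\<integral> \<bar>R - y\<bar>)\<^sup>2 \<le> (\<integral> R) (\<integral> (R - y)\<^sup>2 / R)\<close>.\<close>

lemma weighted_square_bound:
  fixes R y t :: real
  assumes "0 < t" "0 < R"
  shows "2 * \<bar>R - y\<bar> \<le> t * R + (R + y\<^sup>2 / R - 2 * y) / t"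
proof -
  define s where "s = \<bar>R - y\<bar>"
  have s: "s\<^sup>2 = (R - y)\<^sup>2" by (simp add: s_def)
  have "R + y\<^sup>2 / R - 2 * y = s\<^sup>2 / R"
    unfolding s using assms by (simp add: power2_eq_square field_simps)
  then have "t * R + (R + y\<^sup>2 / R - 2 * y) / t - 2 * s = (t * R - s)\<^sup>2 / (t * R)"
    using assms by (simp add: power2_eq_square field_simps)
  also have "\<dots> \<ge> 0" using assms by simp
  finally show ?thesis by (simp add: s_def)
qed

text \<open>With \<open>f = sqrt c\<close>, the quantity \<open>\<integral> R + \<integral> c / R - 2 \<integral> f\<close> equals \<open>\<integral> (R - f)\<^sup>2 / R\<close> and so is
  nonnegative. An asymptotic upper bound for the two integrals, with no lower bound, therefore
  forces it to 0. It also bounds \<open>\<integral> R\<close>, and \<open>L\<^sup>1\<close> convergence follows. Since \<open>c\<close> vanishes where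
  \<open>R\<close> does, the convention \<open>c / 0 = 0\<close> is the right one.\<close>

lemma converges_in_L1_sqrt:
  fixes R :: "nat \<Rightarrow> 'a \<Rightarrow> real" and c :: "'a \<Rightarrow> real"
  assumes nn: "\<And>n x. 0 \<le> R n x" "\<And>x. 0 \<le> c x"
    and R: "\<And>n. integrable M (R n)" and cR: "\<And>n. integrable M (\<lambda>x. c x / R n x)"
    and f: "integrable M (\<lambda>x. sqrt (c x))"
    and ae: "\<And>n. AE x in M. R n x = 0 \<longrightarrow> c x = 0"
    and le: "\<And>e. 0 < e \<Longrightarrow> \<forall>\<^sub>F n in sequentially.
      (\<integral>x. R n x \<partial>M) + (\<integral>x. c x / R n x \<partial>M) \<le> 2 * (\<integral>x. sqrt (c x) \<partial>M) + e"
  shows "converges_in_L1 M R (\<lambda>x. sqrt (c x))"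
proof -
  let ?D = "\<lambda>n. (\<integral>x. R n x \<partial>M) + (\<integral>x. c x / R n x \<partial>M) - 2 * (\<integral>x. sqrt (c x) \<partial>M)"
  let ?F = "\<integral>x. sqrt (c x) \<partial>M"
  have intD: "integrable M (\<lambda>x. R n x + c x / R n x - 2 * sqrt (c x))" for n
    by (intro Bochner_Integration.integrable_diff Bochner_Integration.integrable_add R cR integrable_mult_right f)
  have D: "(\<integral>x. R n x + c x / R n x - 2 * sqrt (c x) \<partial>M) = ?D n" for n
    using R cR f by simp
  have bound: "2 * (\<integral>x. \<bar>R n x - sqrt (c x)\<bar> \<partial>M) \<le> t * (\<integral>x. R n x \<partial>M) + ?D n / t"
    if "0 < t" for t n
  proof -
    have "2 * (\<integral>x. \<bar>R n x - sqrt (c x)\<bar> \<partial>M) = (\<integral>x. 2 * \<bar>R n x - sqrt (c x)\<bar> \<partial>M)" by simp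
    also have "\<dots> \<le> (\<integral>x. t * R n x + (R n x + c x / R n x - 2 * sqrt (c x)) / t \<partial>M)"
    proof (rule integral_mono_AE)
      show "AE x in M. 2 * \<bar>R n x - sqrt (c x)\<bar>
          \<le> t * R n x + (R n x + c x / R n x - 2 * sqrt (c x)) / t"
        using ae[of n]
      proof eventually_elim
        case (elim x)
        show ?case
        proof (cases "R n x = 0")
          case True
          then show ?thesis using elim by simp
        next
          case False
          then have "0 < R n x" using nn(1)[of n x] by simp
          from weighted_square_bound[OF that this, of "sqrt (c x)"] show ?thesis
            using nn(2) by simp
        qed
      qed
    qed (intro integrable_mult_right integrable_abs Bochner_Integration.integrable_diff R f
          Bochner_Integration.integrable_add integrable_divide intD)+
    also have "\<dots> = t * (\<integral>x. R n x \<partial>M) + ?D n / t"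
      by (subst Bochner_Integration.integral_add)
         (use R integrable_divide[OF intD] in \<open>auto simp: D\<close>)
    finally show ?thesis .
  qed
  have Dnn: "0 \<le> ?D n" for n
  proof -
    have "0 \<le> (\<integral>x. R n x + c x / R n x - 2 * sqrt (c x) \<partial>M)"
    proof (rule integral_nonneg_AE)
      show "AE x in M. 0 \<le> R n x + c x / R n x - 2 * sqrt (c x)"
        using ae[of n]
      proof eventually_elim
        case (elim x)
        define y where "y = sqrt (c x)"
        have y: "c x = y\<^sup>2" using nn(2) by (simp add: y_def)
        show ?case
        proof (cases "R n x = 0")
          case False
          then have "R n x + y\<^sup>2 / R n x - 2 * y = (R n x - y)\<^sup>2 / R n x"
            by (simp add: power2_eq_square field_simps)
          also have "\<dots> \<ge> 0" using nn(1) by simp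
          finally show ?thesis unfolding y[symmetric] unfolding y_def .
        qed (use elim in simp)
      qed
    qed
    then show ?thesis by (simp only: D)
  qed
  have D0: "?D \<longlonglongrightarrow> 0"
  proof (rule LIMSEQ_I)
    fix r :: real assume "0 < r"
    then have "0 < r / 2" by simp
    from le[OF this] have "\<forall>\<^sub>F n in sequentially. norm (?D n - 0) < r"
    proof eventually_elim
      case (elim n)
      then show ?case using Dnn[of n] \<open>0 < r\<close> unfolding real_norm_def by linarith
    qed
    then show "\<exists>no. \<forall>n\<ge>no. norm (?D n - 0) < r"
      by (simp add: eventually_sequentially)
  qed
  have F: "0 \<le> ?F" by (intro Bochner_Integration.integral_nonneg) (simp add: nn)
  have "(\<lambda>n. \<integral>x. \<bar>R n x - sqrt (c x)\<bar> \<partial>M) \<longlonglongrightarrow> 0"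
  proof (rule order_tendstoI)
    fix e :: real assume e: "0 < e"
    \<comment> \<open>Any positive \<open>t\<close> with \<open>t * ?F < e\<close> would do, since \<open>t * ?F\<close> is the limit of the bound.\<close>
    define t where "t = e / (?F + 1)"
    have t: "0 < t" using e F by (simp add: t_def)
    have "t * ?F < e" using e F by (simp add: t_def field_simps)
    then have "t * (0 + 2 * ?F) + 0 / t < 2 * e" by simp
    moreover have "(\<lambda>n. t * (?D n + 2 * ?F) + ?D n / t) \<longlonglongrightarrow> t * (0 + 2 * ?F) + 0 / t"
      using t by (intro tendsto_intros D0) auto
    ultimately have "\<forall>\<^sub>F n in sequentially. t * (?D n + 2 * ?F) + ?D n / t < 2 * e"
      by (rule order_tendstoD(2)[rotated])
    then show "\<forall>\<^sub>F n in sequentially. (\<integral>x. \<bar>R n x - sqrt (c x)\<bar> \<partial>M) < e"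
    proof eventually_elim
      case (elim n)
      have "0 \<le> (\<integral>x. c x / R n x \<partial>M)" by (intro Bochner_Integration.integral_nonneg) (simp add: nn)
      then have "t * (\<integral>x. R n x \<partial>M) \<le> t * (?D n + 2 * ?F)"
        using t by (intro mult_left_mono) auto
      then have "t * (\<integral>x. R n x \<partial>M) + ?D n / t \<le> t * (?D n + 2 * ?F) + ?D n / t"
        by (rule add_right_mono)
      with bound[OF t, of n] elim have "2 * (\<integral>x. \<bar>R n x - sqrt (c x)\<bar> \<partial>M) < 2 * e"
        by (meson le_less_trans order_trans)
      then show ?case by simp
    qed
  next
    fix e :: real assume "e < 0"
    moreover have "0 \<le> (\<integral>x. \<bar>R n x - sqrt (c x)\<bar> \<partial>M)" for n by simp
    ultimately show "\<forall>\<^sub>F n in sequentially. e < (\<integral>x. \<bar>R n x - sqrt (c x)\<bar> \<partial>M)"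
      by (intro always_eventually allI) (rule less_le_trans)
  qed
  then show ?thesis
    using R f by (simp add: converges_in_L1_def)
qed

lemma prod_cmod_ratio:
  "(\<Prod>k\<in>I. cmod (poly (P k) z / poly (Q k) z)) = sqrt (sq_prod P I z / sq_prod Q I z)"
proof -
  have sq: "sq_prod P I z = (\<Prod>k\<in>I. cmod (poly (P k) z))\<^sup>2" for P
    by (simp add: sq_prod_def prod_power_distrib)
  have nn: "0 \<le> (\<Prod>k\<in>I. cmod (poly (P k) z))" for P
    by (intro prod_nonneg) auto
  show ?thesis
    unfolding sq real_sqrt_divide using nn by (simp add: norm_divide prod_dividef)
qed

theorem theorem4p1:
  fixes P Q :: "nat \<Rightarrow> complex poly"
    and \<mu> \<nu> \<nu>' :: "complex measure"
    and \<mu>n \<nu>n :: "nat \<Rightarrow> complex measure"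
    and b :: real
  assumes "generalized_riesz_product P" and "generalized_riesz_product Q"
    and "is_tail_product P 0 \<mu>" and "is_tail_product Q 0 \<nu>"
    and "\<And>n. is_tail_product P n (\<mu>n n)"
    and "\<And>n. is_tail_product Q n (\<nu>n n)"
    and "circle_measure \<nu>'" and "\<And>z. z \<in> sphere 0 1 \<Longrightarrow> emeasure \<nu>' {z} = 0"
    and "0 \<le> b" and "b < 1"
    and "\<And>A. A \<in> sets circle \<Longrightarrow>
           emeasure \<nu> A = emeasure \<nu>' A + ennreal b * emeasure (return circle 1) A"
    and "weak_limit (\<lambda>n. density (\<nu>n n) (\<lambda>z. ennreal (sq_prod P {1..n} z))) \<mu>"
    and "weak_limit (\<lambda>n. density (\<mu>n n) (\<lambda>z. ennreal (sq_prod Q {1..n} z))) \<nu>"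
  shows "converges_in_L1 \<nu> (\<lambda>n z. \<Prod>k=1..n. cmod (poly (P k) z / poly (Q k) z))
           (\<lambda>z. sqrt (ac_deriv \<nu> \<mu> z))"
proof -
  define p where "p n z = sq_prod P {1..n} z" for n z
  define q where "q n z = sq_prod Q {1..n} z" for n z
  have nn: "0 \<le> p n z" "0 \<le> q n z" for n z
    by (simp_all add: p_def q_def sq_prod_nonneg)
  have cont: "continuous_on (sphere 0 1) (p n)" "continuous_on (sphere 0 1) (q n)" for n
    using continuous_on_sq_prod by (simp_all add: p_def[abs_def] q_def[abs_def])
  have c\<mu>n: "circle_measure (\<mu>n n)" and c\<nu>n: "circle_measure (\<nu>n n)" for n
    using assms(5,6)[of n] by (auto simp: is_tail_product_def weak_limit_def)
  have c\<mu>: "circle_measure \<mu>" and c\<nu>: "circle_measure \<nu>"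
    using assms(3,4) by (auto simp: is_tail_product_def weak_limit_def)
  have \<mu>: "\<mu> = density (\<mu>n n) (\<lambda>z. ennreal (p n z))" for n
    unfolding p_def by (rule tail_product_factorization[OF assms(3,5)])
  have \<nu>: "\<nu> = density (\<nu>n n) (\<lambda>z. ennreal (q n z))" for n
    unfolding q_def by (rule tail_product_factorization[OF assms(4,6)])
  let ?c = "ac_deriv \<nu> \<mu>"
  have eq: "sets \<mu> = sets \<nu>" using circle_measureD[OF c\<mu>] circle_measureD[OF c\<nu>] by simp
  note fin = circle_measureD(1)[OF c\<nu>] circle_measureD(1)[OF c\<mu>] eq
  have one: "continuous_on (sphere 0 1) (\<lambda>z::complex. 1::real)" "\<And>z::complex. 0 < (1::real)"
    by auto
  have R: "integrable \<nu> (\<lambda>z. sqrt (p n z / q n z))" for n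
    by (rule integrable_sqrt_ratio[OF c\<nu>n cont(2,1) one(1) nn(2,1) one(2) \<nu>])
  have R': "integrable \<mu> (\<lambda>z. sqrt (q n z / p n z))" for n
    by (rule integrable_sqrt_ratio[OF c\<mu>n cont(1,2) one(1) nn(1,2) one(2) \<mu>])
  have inv: "?c z / sqrt (p n z / q n z) = ?c z * sqrt (q n z / p n z)" for n z
    by (simp add: real_sqrt_divide)
  have nnr: "0 \<le> sqrt (q n z / p n z)" for n z
    by (simp add: nn)
  have "converges_in_L1 \<nu> (\<lambda>n z. sqrt (p n z / q n z)) (\<lambda>z. sqrt (?c z))"
  proof (rule converges_in_L1_sqrt)
    show "0 \<le> sqrt (p n z / q n z)" for n z by (simp add: nn)
    show "0 \<le> ?c z" for z by (rule ac_deriv_nonneg)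
    show "integrable \<nu> (\<lambda>z. sqrt (p n z / q n z))" for n by (rule R)
    show "integrable \<nu> (\<lambda>z. ?c z / sqrt (p n z / q n z))" for n
      unfolding inv by (rule integrable_ac_deriv_mult[OF fin R' nnr])
    show "integrable \<nu> (\<lambda>z. sqrt (?c z))" by (rule integrable_sqrt_ac_deriv[OF fin])
    show "AE z in \<nu>. sqrt (p n z / q n z) = 0 \<longrightarrow> ?c z = 0" for n
    proof -
      \<comment> \<open>By the factorizations, \<open>\<nu>\<close> does not charge the zeros of the \<open>Q\<close>-product nor \<open>\<mu>\<close> those of the
        \<open>P\<close>-product.\<close>
      have "AE z in \<nu>. q n z \<noteq> 0"
        unfolding \<nu>[of n]
        using measurable_continuous_circle[OF circle_measureD(2)[OF c\<nu>n] cont(2)]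
        by (subst AE_density) auto
      moreover have "AE z in \<mu>. p n z \<noteq> 0"
        unfolding \<mu>[of n]
        using measurable_continuous_circle[OF circle_measureD(2)[OF c\<mu>n] cont(1)]
        by (subst AE_density) auto
      from AE_ac_deriv[OF fin this] have "AE z in \<nu>. ?c z \<noteq> 0 \<longrightarrow> p n z \<noteq> 0" .
      ultimately show ?thesis by eventually_elim auto
    qed
    fix e :: real assume "0 < e"
    obtain h :: "complex \<Rightarrow> real" where h: "continuous_on UNIV h" "\<And>z. 0 < h z"
      and less: "(\<integral>z. h z \<partial>\<mu>) + (\<integral>z. 1 / h z \<partial>\<nu>) < 2 * (\<integral>z. sqrt (?c z) \<partial>\<nu>) + e"
      by (rule approx_affinity[OF c\<mu> c\<nu> \<open>0 < e\<close>]) (rule that)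
    have hc: "continuous_on (sphere 0 1) h" by (rule continuous_on_subset[OF h(1) subset_UNIV])
    have hc': "continuous_on (sphere 0 1) (\<lambda>z. 1 / h z)"
      using h(2) by (intro continuous_intros hc) (auto simp: less_imp_neq[symmetric])
    have h': "0 < 1 / h z" for z using h(2) by simp
    \<comment> \<open>Half the sum of the two weighted bounds, for \<open>R\<^sub>n\<close> with weight \<open>h\<close> and for \<open>1 / R\<^sub>n\<close> with
      weight \<open>1 / h\<close>. The hypotheses on mixed products say that both bounds have the same limit.\<close>
    let ?U = "\<lambda>n. ((\<integral>z. p n z * h z \<partial>\<nu>n n) + (\<integral>z. 1 / h z \<partial>\<nu>)
      + ((\<integral>z. q n z * (1 / h z) \<partial>\<mu>n n) + (\<integral>z. h z \<partial>\<mu>))) / 2"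
    have upper: "(\<integral>z. sqrt (p n z / q n z) \<partial>\<nu>) + (\<integral>z. ?c z / sqrt (p n z / q n z) \<partial>\<nu>) \<le> ?U n" for n
    proof -
      have "2 * (\<integral>z. sqrt (p n z / q n z) \<partial>\<nu>) \<le> (\<integral>z. p n z * h z \<partial>\<nu>n n) + (\<integral>z. 1 / h z \<partial>\<nu>)"
        by (rule integral_sqrt_ratio_le[OF c\<nu>n cont(2,1) hc nn(2,1) h(2) \<nu>])
      moreover have "(\<integral>z. ?c z / sqrt (p n z / q n z) \<partial>\<nu>) \<le> (\<integral>z. sqrt (q n z / p n z) \<partial>\<mu>)"
        unfolding inv by (rule integral_ac_deriv_mult_le[OF fin R' nnr])
      moreover have "2 * (\<integral>z. sqrt (q n z / p n z) \<partial>\<mu>)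
          \<le> (\<integral>z. q n z * (1 / h z) \<partial>\<mu>n n) + (\<integral>z. 1 / (1 / h z) \<partial>\<mu>)"
        by (rule integral_sqrt_ratio_le[OF c\<mu>n cont(1,2) hc' nn(1,2) h' \<mu>])
      ultimately show ?thesis by simp
    qed
    have "(\<lambda>n. \<integral>z. h z \<partial>density (\<nu>n n) (\<lambda>z. ennreal (p n z))) \<longlonglongrightarrow> (\<integral>z. h z \<partial>\<mu>)"
      using assms(12) hc unfolding weak_limit_def p_def by blast
    then have lim1: "(\<lambda>n. \<integral>z. p n z * h z \<partial>\<nu>n n) \<longlonglongrightarrow> (\<integral>z. h z \<partial>\<mu>)"
      by (simp only: integral_density_continuous[OF circle_measureD(2)[OF c\<nu>n] cont(1) nn(1) hc])
    have "(\<lambda>n. \<integral>z. 1 / h z \<partial>density (\<mu>n n) (\<lambda>z. ennreal (q n z))) \<longlonglongrightarrow> (\<integral>z. 1 / h z \<partial>\<nu>)"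
      using assms(13) hc' unfolding weak_limit_def q_def by blast
    then have lim2: "(\<lambda>n. \<integral>z. q n z * (1 / h z) \<partial>\<mu>n n) \<longlonglongrightarrow> (\<integral>z. 1 / h z \<partial>\<nu>)"
      by (simp only: integral_density_continuous[OF circle_measureD(2)[OF c\<mu>n] cont(2) nn(2) hc'])
    have "?U \<longlonglongrightarrow> ((\<integral>z. h z \<partial>\<mu>) + (\<integral>z. 1 / h z \<partial>\<nu>) + ((\<integral>z. 1 / h z \<partial>\<nu>) + (\<integral>z. h z \<partial>\<mu>))) / 2"
      by (intro tendsto_intros lim1 lim2) auto
    moreover have "(a + b + (b + a)) / 2 = a + b" for a b :: real by simp
    ultimately have "?U \<longlonglongrightarrow> (\<integral>z. h z \<partial>\<mu>) + (\<integral>z. 1 / h z \<partial>\<nu>)" by (simp only:)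
    from order_tendstoD(2)[OF this less]
    show "\<forall>\<^sub>F n in sequentially. (\<integral>z. sqrt (p n z / q n z) \<partial>\<nu>)
        + (\<integral>z. ?c z / sqrt (p n z / q n z) \<partial>\<nu>) \<le> 2 * (\<integral>z. sqrt (?c z) \<partial>\<nu>) + e"
      by (rule eventually_mono) (rule order_trans[OF upper less_imp_le])
  qed
  then show ?thesis
    unfolding prod_cmod_ratio p_def q_def .
qed

end
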